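(* Let $X$ be a connected topological space whose weak separate number satisfies $R(X)<\mathfrak{c}$. Then each continuous locally extremal function $f:X\to\mathbb{R}$ is constant.
   Context: A function $f:X\to\mathbb{R}$ on a topological space $X$ is locally extremal if each point $x\in X$ is a point of local minimum or of local maximum of $f$; that is, for each $x\in X$ there is a neighborhood $O$ of $x$ in $X$ such that either $f(x)\le f(y)$ for all $y\in O$, or $f(x)\ge f(y)$ for all $y\in O$. A topological space $Y$ is weakly separated if each point $x\in Y$ can be assigned an open neighborhood $O_x\subset Y$ such that for any two distinct points $x,y\in Y$ either $x\notin O_y$ or $y\notin O_x$. The weak separate number of a topological space $X$ is the cardinal $$R(X)=\sup\{|Y| : Y \text{ is a weakly separated subspace of } X\}.$$ Here $\mathfrak{c}$ denotes the cardinality of the continuum. *)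

theory Defs
  imports "HOL-Analysis.Analysis"
begin

unbundle cardinal_syntax

definition locally_extremal :: "'a topology \<Rightarrow> ('a \<Rightarrow> real) \<Rightarrow> bool" where
  "locally_extremal X f \<longleftrightarrow>
     (\<forall>x\<in>topspace X. \<exists>U. openin X U \<and> x \<in> U \<and>
        ((\<forall>y\<in>U. f x \<le> f y) \<or> (\<forall>y\<in>U. f x \<ge> f y)))"

definition weakly_separated_space :: "'a topology \<Rightarrow> bool" where
  "weakly_separated_space Y \<longleftrightarrow>
     (\<exists>N. (\<forall>x\<in>topspace Y. openin Y (N x) \<and> x \<in> N x) \<and>
          (\<forall>x\<in>topspace Y. \<forall>y\<in>topspace Y. x \<noteq> y \<longrightarrow> x \<notin> N y \<or> y \<notin> N x))"

text \<open>Cardinals are represented by well-order relations, so the supremum of the cardinalities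
  of a family of sets is determined only up to \<open>=o\<close>; one representative is chosen on the
  element type itself. The lemmas below show that it exists and that it is least among the
  upper bounds on any type.\<close>

definition card_Sup :: "'a set set \<Rightarrow> 'a rel" where
  "card_Sup \<A> = (SOME r. Card_order r \<and> (\<forall>A\<in>\<A>. |A| \<le>o r) \<and>
     (\<forall>r'::'a rel. Card_order r' \<and> (\<forall>A\<in>\<A>. |A| \<le>o r') \<longrightarrow> r \<le>o r'))"

definition weak_separate_number :: "'a topology \<Rightarrow> 'a rel" where
  "weak_separate_number X =
     card_Sup {Y. Y \<subseteq> topspace X \<and> weakly_separated_space (subtopology X Y)}"

lemma card_Sup_aux:
  fixes \<A> :: "'a set set"
  shows "Card_order (card_Sup \<A>) \<and> (\<forall>A\<in>\<A>. |A| \<le>o card_Sup \<A>) \<and>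
     (\<forall>r'::'a rel. Card_order r' \<and> (\<forall>A\<in>\<A>. |A| \<le>o r') \<longrightarrow> card_Sup \<A> \<le>o r')"
  unfolding card_Sup_def
proof (rule someI_ex)
  let ?R = "{r::'a rel. Card_order r \<and> (\<forall>A\<in>\<A>. |A| \<le>o r)}"
  have "|UNIV::'a set| \<in> ?R"
    by (simp add: card_of_Card_order card_of_mono1)
  then have "\<exists>r\<in>?R. \<forall>r'\<in>?R. r \<le>o r'"
    by (intro exists_minim_Card_order) auto
  then show "\<exists>r::'a rel. Card_order r \<and> (\<forall>A\<in>\<A>. |A| \<le>o r) \<and>
     (\<forall>r'::'a rel. Card_order r' \<and> (\<forall>A\<in>\<A>. |A| \<le>o r') \<longrightarrow> r \<le>o r')"
    by blast
qed

lemma Card_order_card_Sup: "Card_order (card_Sup \<A>)"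
  using card_Sup_aux by blast

lemma card_Sup_upper: "A \<in> \<A> \<Longrightarrow> |A| \<le>o card_Sup \<A>"
  using card_Sup_aux by blast

lemma card_Sup_least:
  fixes \<A> :: "'a set set" and r :: "'b rel"
  assumes r: "Card_order r" and ub: "\<And>A. A \<in> \<A> \<Longrightarrow> |A| \<le>o r"
  shows "card_Sup \<A> \<le>o r"
proof -
  have least: "card_Sup \<A> \<le>o |B|" if "\<And>A. A \<in> \<A> \<Longrightarrow> |A| \<le>o |B|" for B :: "'a set"
    using card_Sup_aux[of \<A>] that card_of_Card_order[of B] by metis
  have rF: "|Field r| =o r"
    using r by (rule card_of_Field_ordIso)
  consider "|UNIV::'a set| \<le>o |Field r|" | "|Field r| \<le>o |UNIV::'a set|"
    using ordLeq_total[OF card_of_Well_order card_of_Well_order] by metis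
  then show ?thesis
  proof cases
    case 1
    have "card_Sup \<A> \<le>o |UNIV::'a set|"
      by (rule least) (simp add: card_of_mono1)
    from ordLeq_ordIso_trans[OF ordLeq_transitive[OF this 1] rF] show ?thesis .
  next
    case 2
    then obtain B :: "'a set" where B: "|Field r| =o |B|"
      unfolding internalize_card_of_ordLeq2[of "Field r" "UNIV::'a set"] by auto
    have rB: "r =o |B|"
      by (rule ordIso_transitive[OF ordIso_symmetric[OF rF] B])
    have "card_Sup \<A> \<le>o |B|"
      by (rule least) (rule ordLeq_ordIso_trans[OF ub rB])
    from ordLeq_ordIso_trans[OF this ordIso_symmetric[OF rB]] show ?thesis .
  qed
qed

end

(* The values attained at points of local minimum form a set of cardinality at most R(X): choose
   one such point for each value, with its witnessing neighbourhood. If f x < f y, then x is not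
   in the neighbourhood of y, so the chosen points form a weakly separated subspace. The same holds
   for maxima, by negation. A locally extremal f thus has fewer than continuum many values, whereas
   a connected set of reals with two points has continuum many. *)
theory Submission
  imports Defs
begin

text \<open>Only minima are named: the local maxima of \<open>f\<close> are the local minima of its
  negation, so each lemma below also serves maxima.\<close>

definition local_min_points :: "'a topology \<Rightarrow> ('a \<Rightarrow> real) \<Rightarrow> 'a set" where
  "local_min_points X f = {x \<in> topspace X. \<exists>U. openin X U \<and> x \<in> U \<and> (\<forall>y\<in>U. f x \<le> f y)}"

lemma weakly_separated_local_min_points:
  assumes Y: "Y \<subseteq> local_min_points X f" and inj: "inj_on f Y"
  shows "weakly_separated_space (subtopology X Y)"
proof -
  from Y have "\<forall>x\<in>Y. \<exists>U. openin X U \<and> x \<in> U \<and> (\<forall>y\<in>U. f x \<le> f y)"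
    by (auto simp: local_min_points_def)
  then obtain U where U: "\<And>x. x \<in> Y \<Longrightarrow> openin X (U x) \<and> x \<in> U x \<and> (\<forall>y\<in>U x. f x \<le> f y)"
    by metis
  have top: "topspace (subtopology X Y) = Y"
    using Y by (auto simp: local_min_points_def)
  show ?thesis
    unfolding weakly_separated_space_def top
  proof (intro exI[of _ "\<lambda>x. Y \<inter> U x"] conjI ballI impI)
    fix x assume "x \<in> Y"
    then show "openin (subtopology X Y) (Y \<inter> U x)" "x \<in> Y \<inter> U x"
      using U by (auto intro: openin_subtopology_Int2)
  next
    fix x y assume "x \<in> Y" "y \<in> Y" "x \<noteq> y"
    moreover from this have "f x \<noteq> f y"
      using inj by (auto dest: inj_onD)
    \<comment> \<open>If each point lay in the neighbourhood of the other, then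
      \<open>f x \<le> f y\<close> and \<open>f y \<le> f x\<close>, against
      \<open>f x \<noteq> f y\<close>.\<close>
    ultimately show "x \<notin> Y \<inter> U y \<or> y \<notin> Y \<inter> U x"
      using U by (meson IntD2 order_antisym)
  qed
qed

lemma card_local_min_values:
  "|f ` local_min_points X f| \<le>o weak_separate_number X"
proof -
  \<comment> \<open>\<open>Y\<close> picks one point from each nonempty fibre of \<open>f\<close>
    over the local minimum points.\<close>
  obtain Y where Y: "Y \<subseteq> local_min_points X f" "inj_on f Y" "f ` local_min_points X f = f ` Y"
    by (metis subset_image_inj subset_refl)
  have "Y \<subseteq> topspace X"
    using Y(1) by (auto simp: local_min_points_def)
  then have "|Y| \<le>o weak_separate_number X"
    unfolding weak_separate_number_def
    using weakly_separated_local_min_points[OF Y(1,2)] by (intro card_Sup_upper) simp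
  then show ?thesis
    unfolding Y(3) by (rule ordLeq_transitive[OF card_of_image])
qed

text \<open>By connectedness the set contains the nondegenerate closed interval between
  \<open>a\<close> and \<open>b\<close>, which already has the cardinality of the continuum.\<close>

lemma connected_real_eqpoll_UNIV:
  fixes S :: "real set"
  assumes "connected S" "a \<in> S" "b \<in> S" "a \<noteq> b"
  shows "S \<approx> (UNIV :: real set)"
proof -
  have "min a b < max a b" "{min a b..max a b} \<subseteq> S"
    using assms connected_contains_Icc[OF assms(1)] by (auto simp: min_def max_def)
  then show ?thesis
    by (intro eqpoll_real_subset[of "min a b" "max a b"]) auto
qed

theorem corollary1:
  fixes X :: "'a topology" and f :: "'a \<Rightarrow> real"
  assumes "connected_space X"
    and "weak_separate_number X <o |UNIV :: real set|"
    and "continuous_map X euclideanreal f"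
    and "locally_extremal X f"
  shows "f constant_on topspace X"
proof (rule ccontr)
  assume "\<not> f constant_on topspace X"
  then obtain x y where xy: "x \<in> topspace X" "y \<in> topspace X" "f x \<noteq> f y"
    unfolding constant_on_def by metis
  define A where "A = f ` local_min_points X f"
  \<comment> \<open>The points are selected by the negated function, but \<open>B\<close> collects
    values of \<open>f\<close> itself, so that \<open>A \<union> B\<close> covers the range of
    \<open>f\<close>.\<close>
  define B where "B = f ` local_min_points X (\<lambda>x. - f x)"
  have "connected (f ` topspace X)"
    using connectedin_continuous_map_image[OF assms(3)] assms(1)
    by (metis connectedin_iff_connected connectedin_topspace)
  then have eq: "f ` topspace X \<approx> (UNIV :: real set)"
    using xy by (intro connected_real_eqpoll_UNIV[of _ "f x" "f y"]) auto
  have "topspace X \<subseteq> local_min_points X f \<union> local_min_points X (\<lambda>x. - f x)"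
  proof
    fix x assume x: "x \<in> topspace X"
    with assms(4) obtain U where "openin X U" "x \<in> U" "(\<forall>y\<in>U. f x \<le> f y) \<or> (\<forall>y\<in>U. f x \<ge> f y)"
      unfolding locally_extremal_def by meson
    with x show "x \<in> local_min_points X f \<union> local_min_points X (\<lambda>x. - f x)"
      unfolding local_min_points_def by auto
  qed
  then have sub: "f ` topspace X \<subseteq> A \<union> B"
    unfolding A_def B_def by blast
  have "|UNIV :: real set| \<le>o |A \<union> B|"
    using eq unfolding eqpoll_iff_card_of_ordIso
    by (rule ordIso_ordLeq_trans[OF ordIso_symmetric card_of_mono1[OF sub]])
  \<comment> \<open>Two sets below an infinite cardinal have their union below it.\<close>
  moreover have "|A \<union> B| <o |UNIV :: real set|"
  proof (rule card_of_Un_ordLess_infinite)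
    show "infinite (UNIV :: real set)"
      by (rule infinite_UNIV_char_0)
    show "|A| <o |UNIV :: real set|"
      unfolding A_def by (rule ordLeq_ordLess_trans[OF card_local_min_values assms(2)])
    \<comment> \<open>The cardinality lemma for the negated function bounds the set of negated
      values; \<open>B\<close> is the image of that set under \<open>uminus\<close>, hence no
      larger.\<close>
    have "B = uminus ` (\<lambda>x. - f x) ` local_min_points X (\<lambda>x. - f x)"
      by (simp add: B_def image_image)
    then have "|B| \<le>o weak_separate_number X"
      using ordLeq_transitive[OF card_of_image card_local_min_values] by metis
    then show "|B| <o |UNIV :: real set|"
      by (rule ordLeq_ordLess_trans[OF _ assms(2)])
  qed
  ultimately show False
    using not_ordLess_ordLeq by blast
qed

end
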